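(* Let $p,q\ge 1$ be integers with $p$ odd. Let $X=\begin{bmatrix} A & B\\ C& D\end{bmatrix}$ be a complex $(p+q)\times(p+q)$ matrix, partitioned so that $A$ is $p\times p$, $B=[b_{i,j}]$ is $p\times q$, $C=[c_{i,j}]$ is $q\times p$, and $D$ is $q\times q$. Then $$X\big(J_p(0)\oplus \Gamma_q\big)+\big(J_p(0)\oplus \Gamma_q\big)X^T=0$$ if and only if $AJ_p(0)+J_p(0)A^T=0$, $D\Gamma_q+\Gamma_qD^T=0$, and there exist constants $\beta_1,\beta_2,\ldots,\beta_q\in\mathbb{C}$ such that for $1\le i\le q$, $1\le j\le p$, $$c_{i,j}=\begin{cases}0&\text{if } j \text{ is even},\\ (-1)^{\lfloor j/2\rfloor(q-1)}\displaystyle\sum_{\ell=0}^{i-1}S_{\lfloor j/2\rfloor}(\ell)\,\beta_{i-\ell}&\text{if } j\text{ is odd},\end{cases}$$ and for $1\le i\le p$, $1\le j\le q$, $$b_{i,j}=\begin{cases}0&\text{if } i\text{ is odd},\\ (-1)^{j+(k+1)(q-1)}\displaystyle\sum_{\ell=0}^{q-j}G_{k-1}(\ell)\,\beta_{q-j-\ell+1}&\text{if } i=2k.\end{cases}$$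
   Context: $M^T$ denotes the transpose (no conjugation). $J_n(0)$ is the $n\times n$ Jordan block with eigenvalue $0$: its $(i,i+1)$ entries equal $1$ for $1\le i\le n-1$ and all other entries are $0$. $\Gamma_q$ is the $q\times q$ matrix whose entries are $[\Gamma_q]_{q+1-m,\,m}=(-1)^{m+1}$ for $1\le m\le q$, $[\Gamma_q]_{q+2-m,\,m}=(-1)^{m}$ for $2\le m\le q$, and $0$ elsewhere; that is, $$\Gamma_q=\begin{bmatrix}0&0&0&\cdots&0&(-1)^{q+1}\\0&0&0&\cdots&(-1)^q&(-1)^q\\ \vdots&\vdots&\vdots&&\vdots&\vdots\\0&0&1&\cdots&0&0\\0&-1&-1&\cdots&0&0\\1&1&0&\cdots&0&0\end{bmatrix}.$$ $M\oplus N$ denotes the block-diagonal direct sum. For integers $k,n\ge 0$, $S_k(n)$ is the coordination sequence of the $k$-dimensional cubic lattice, i.e. the number of points of $\mathbb{Z}^k$ at ($\ell^1$) distance exactly $n$ from the origin (with $\mathbb{Z}^0$ a single point, the origin); equivalently $\left(\frac{1+x}{1-x}\right)^k=\sum_{n=0}^\infty S_k(n)x^n$. Also $G_k(n)=\sum_{\ell=0}^{n}S_k(\ell)$, the number of points of $\mathbb{Z}^k$ at distance at most $n$ from the origin. *)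

theory Defs
  imports Complex_Main "Jordan_Normal_Form.Jordan_Normal_Form"
begin

text \<open>
  Indices of the matrix type start at 0. To keep every index formula in its customary 1-based
  form, \<open>entry M i j\<close> denotes the entry of \<open>M\<close> in row \<open>i\<close> and column \<open>j\<close>,
  counted from 1; it is meant for \<open>i, j \<ge> 1\<close> only.
\<close>

definition entry :: "'a mat \<Rightarrow> nat \<Rightarrow> nat \<Rightarrow> 'a" where
  "entry M i j = M $$ (i - 1, j - 1)"

text \<open>
  The abstraction below receives 0-based indices, so \<open>i + 1\<close> and \<open>m = j + 1\<close> are the
  1-based row and column. In the second case \<open>i < q\<close> forces \<open>m \<ge> 2\<close>.
\<close>

definition Gamma_block :: "nat \<Rightarrow> complex mat" where
  "Gamma_block q = mat q q (\<lambda>(i, j). let m = j + 1 in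
     if i + 1 = q + 1 - m then (-1) ^ (m + 1)
     else if i + 1 = q + 2 - m then (-1) ^ m
     else 0)"

text \<open>
  The points of the \<open>k\<close>-dimensional integer lattice are the integer lists of length \<open>k\<close>;
  for \<open>k = 0\<close> this is the single point \<open>[]\<close>, which has distance 0.
\<close>

definition coord_seq :: "nat \<Rightarrow> nat \<Rightarrow> nat" where
  "coord_seq k n = card {x :: int list. length x = k \<and> (\<Sum>a\<leftarrow>x. \<bar>a\<bar>) = int n}"

definition coord_seq_sum :: "nat \<Rightarrow> nat \<Rightarrow> nat" where
  "coord_seq_sum k n = (\<Sum>l=0..n. coord_seq k l)"

end

theory Submission
  imports Defs "HOL-Computational_Algebra.Formal_Power_Series"
begin

text \<open>
  Comparing blocks, the equation splits into the two conditions on \<open>A\<close> and \<open>D\<close> and, writing \<open>J\<close> for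
  the Jordan block and \<open>\<Gamma>\<close> for the matrix with alternating signs, the coupled pair
  \<open>B \<Gamma> + J C\<^sup>T = 0\<close>, \<open>C J + \<Gamma> B\<^sup>T = 0\<close>. Multiplication by \<open>J\<close> only shifts, so
  the pair expresses each of the neighbouring columns \<open>c\<^sub>i\<^sub>+\<^sub>1\<close> and \<open>c\<^sub>i\<^sub>-\<^sub>1\<close> of \<open>C\<close> through the
  row \<open>b\<^sub>i\<close> of \<open>B\<close>.

  The idea is to read vectors of length \<open>q\<close> as power series modulo \<open>x\<^sup>q\<close>. Let \<open>v\<^sub>i\<close> be the series of
  \<open>b\<^sub>i\<close>, read backwards and with alternating signs. In these coordinates the antitriangular matrices
  \<open>\<Gamma>\<^sup>T\<close> and \<open>\<Gamma>\<close> become, up to sign, multiplication by \<open>1 + x\<close> and by \<open>1 - x\<close>, and the pair reads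
  \<open>c\<^sub>i\<^sub>+\<^sub>1 = (1 + x) v\<^sub>i\<close>, \<open>c\<^sub>i\<^sub>-\<^sub>1 = \<epsilon> (1 - x) v\<^sub>i\<close> for \<open>1 \<le> i \<le> p\<close>, where
  \<open>\<epsilon> = (-1)\<^bsup>q-1\<^esup>\<close> and \<open>c\<^sub>0 = c\<^sub>p\<^sub>+\<^sub>1 = 0\<close> (lemma \<open>off_diagonal_blocks_iff_chain\<close>).

  As \<open>1 - x\<close> is a unit, passing from \<open>c\<^sub>i\<^sub>-\<^sub>1\<close> to \<open>c\<^sub>i\<^sub>+\<^sub>1\<close> is multiplication by
  \<open>\<epsilon> (1 + x) / (1 - x)\<close>. Starting at \<open>c\<^sub>0 = 0\<close>, the columns with even and the rows with odd index
  vanish; since \<open>p\<close> is odd, this chain also ends at \<open>c\<^sub>p\<^sub>+\<^sub>1 = 0\<close>. The other chain starts at the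
  unconstrained column \<open>c\<^sub>1\<close>, whose entries are the constants \<open>\<beta>\<close>, and gives \<open>c\<^sub>2\<^sub>k\<^sub>+\<^sub>1\<close> as
  \<open>\<epsilon>\<^sup>k ((1 + x) / (1 - x))\<^sup>k c\<^sub>1\<close> and \<open>v\<^sub>2\<^sub>k\<close> as
  \<open>\<epsilon>\<^sup>k ((1 + x) / (1 - x))\<^sup>k\<^sup>-\<^sup>1 (1 - x)\<^sup>-\<^sup>1 c\<^sub>1\<close> (lemma \<open>chain_solution\<close>). The factors
  are the generating functions of the spheres and of the balls of the cubic lattice, which is how
  the coordination sequence enters (lemmas \<open>sphere_fps_Suc\<close> and \<open>ball_fps\<close>); comparing
  coefficients gives the formulas.
\<close>

section \<open>Generating functions of the lattice counts\<close>

definition lattice_sphere :: "nat \<Rightarrow> nat \<Rightarrow> int list set" where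
  "lattice_sphere k n = {x. length x = k \<and> (\<Sum>a\<leftarrow>x. \<bar>a\<bar>) = int n}"

lemma coord_seq_eq_card: "coord_seq k n = card (lattice_sphere k n)"
  by (simp add: coord_seq_def lattice_sphere_def)

lemma finite_lattice_sphere: "finite (lattice_sphere k n)"
proof (rule finite_subset)
  show "lattice_sphere k n \<subseteq> {x. set x \<subseteq> {- int n..int n} \<and> length x = k}"
  proof (clarsimp simp: lattice_sphere_def)
    fix x :: "int list" and a
    assume sum: "(\<Sum>a\<leftarrow>x. \<bar>a\<bar>) = int n" and a: "a \<in> set x"
    have "\<bar>a\<bar> \<le> (\<Sum>a\<leftarrow>x. \<bar>a\<bar>)"
      by (rule member_le_sum_list) (use a in auto)
    with sum show "- int n \<le> a \<and> a \<le> int n" by linarith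
  qed
  show "finite {x. set x \<subseteq> {- int n..int n} \<and> length x = k}"
    by (rule finite_lists_length_eq) simp
qed

lemma coord_seq_0: "coord_seq 0 n = (if n = 0 then 1 else 0)"
proof -
  have "lattice_sphere 0 n = (if n = 0 then {[]} else {})"
    by (auto simp: lattice_sphere_def)
  then show ?thesis by (simp add: coord_seq_eq_card)
qed

lemma coord_seq_at_0: "coord_seq k 0 = 1"
proof -
  have "x = replicate (length x) 0" if "(\<Sum>a\<leftarrow>x. \<bar>a\<bar>) = (0::int)" for x :: "int list"
    using that
  proof (induction x)
    case (Cons a x)
    have "0 \<le> (\<Sum>a\<leftarrow>x. \<bar>a\<bar>)" by (rule sum_list_nonneg) auto
    with Cons show ?case by auto
  qed simp
  then have "lattice_sphere k 0 = {replicate k 0}"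
    by (auto simp: lattice_sphere_def sum_list_replicate)
  then show ?thesis by (simp add: coord_seq_eq_card)
qed

lemma card_first_coord_zero:
  "card {x \<in> lattice_sphere (Suc k) n. hd x = 0} = coord_seq k n"
proof -
  have "{x \<in> lattice_sphere (Suc k) n. hd x = 0} = (#) 0 ` lattice_sphere k n"
    by (auto simp: lattice_sphere_def image_iff length_Suc_conv)
  then show ?thesis by (simp add: coord_seq_eq_card card_image)
qed

text \<open>
  Sort the points at distance \<open>n + 1\<close> by the sign of the first coordinate. Moving a nonzero first
  coordinate one step towards the origin gives a point at distance \<open>n\<close>; the points of that sphere
  with first coordinate 0 are reached from both sides, all the others from one.
\<close>

lemma coord_seq_rec:
  "coord_seq (Suc k) (Suc n) = coord_seq (Suc k) n + coord_seq k (Suc n) + coord_seq k n"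
proof -
  let ?S = "lattice_sphere (Suc k)"
  have pos: "card {x \<in> ?S (Suc n). hd x > 0} = card {x \<in> ?S n. hd x \<ge> 0}"
    by (rule bij_betw_same_card[of "\<lambda>x. (hd x - 1) # tl x"],
        rule bij_betw_byWitness[where f' = "\<lambda>x. (hd x + 1) # tl x"])
       (auto simp: lattice_sphere_def length_Suc_conv)
  have neg: "card {x \<in> ?S (Suc n). hd x < 0} = card {x \<in> ?S n. hd x \<le> 0}"
    by (rule bij_betw_same_card[of "\<lambda>x. (hd x + 1) # tl x"],
        rule bij_betw_byWitness[where f' = "\<lambda>x. (hd x - 1) # tl x"])
       (auto simp: lattice_sphere_def length_Suc_conv)
  have "?S (Suc n) = {x \<in> ?S (Suc n). hd x > 0} \<union>
      ({x \<in> ?S (Suc n). hd x = 0} \<union> {x \<in> ?S (Suc n). hd x < 0})" by auto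
  then have "card (?S (Suc n)) = card ({x \<in> ?S (Suc n). hd x > 0} \<union>
      ({x \<in> ?S (Suc n). hd x = 0} \<union> {x \<in> ?S (Suc n). hd x < 0}))" by argo
  also have "\<dots> = card {x \<in> ?S (Suc n). hd x > 0} +
      (card {x \<in> ?S (Suc n). hd x = 0} + card {x \<in> ?S (Suc n). hd x < 0})"
    by (subst card_Un_disjoint, auto simp: finite_lattice_sphere)+
  finally have upper: "card (?S (Suc n)) =
      card {x \<in> ?S n. hd x \<ge> 0} + card {x \<in> ?S n. hd x \<le> 0} + coord_seq k (Suc n)"
    by (simp add: pos neg card_first_coord_zero)
  have "{x \<in> ?S n. hd x \<ge> 0} \<union> {x \<in> ?S n. hd x \<le> 0} = ?S n"
    "{x \<in> ?S n. hd x \<ge> 0} \<inter> {x \<in> ?S n. hd x \<le> 0} = {x \<in> ?S n. hd x = 0}"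
    by auto
  then have "card {x \<in> ?S n. hd x \<ge> 0} + card {x \<in> ?S n. hd x \<le> 0} =
      card (?S n) + coord_seq k n"
    using card_Un_Int[of "{x \<in> ?S n. hd x \<ge> 0}" "{x \<in> ?S n. hd x \<le> 0}"]
    by (simp add: finite_lattice_sphere card_first_coord_zero)
  with upper show ?thesis by (simp add: coord_seq_eq_card)
qed

definition sphere_fps :: "nat \<Rightarrow> complex fps" where
  "sphere_fps k = Abs_fps (\<lambda>n. of_nat (coord_seq k n))"

definition ball_fps :: "nat \<Rightarrow> complex fps" where
  "ball_fps k = Abs_fps (\<lambda>n. of_nat (coord_seq_sum k n))"

lemma sphere_fps_0: "sphere_fps 0 = 1"
  by (rule fps_ext) (simp add: sphere_fps_def coord_seq_0)

text \<open>
  Together with \<open>sphere_fps_0\<close> this identifies the sphere series as \<open>((1 + x) / (1 - x))\<^sup>k\<close>. Clearing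
  the denominator turns it into the recurrence \<open>coord_seq_rec\<close>.
\<close>

lemma sphere_fps_Suc: "(1 - fps_X) * sphere_fps (Suc k) = (1 + fps_X) * sphere_fps k"
proof (rule fps_ext)
  fix n
  show "fps_nth ((1 - fps_X) * sphere_fps (Suc k)) n = fps_nth ((1 + fps_X) * sphere_fps k) n"
    by (cases n) (simp_all add: sphere_fps_def coord_seq_rec coord_seq_at_0 algebra_simps)
qed

lemma ball_fps: "(1 - fps_X) * ball_fps k = sphere_fps k"
proof (rule fps_ext)
  fix n
  show "fps_nth ((1 - fps_X) * ball_fps k) n = fps_nth (sphere_fps k) n"
    by (cases n) (simp_all add: sphere_fps_def ball_fps_def coord_seq_sum_def algebra_simps)
qed

lemma ball_fps_Suc: "(1 + fps_X) * ball_fps k = sphere_fps (Suc k)"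
proof -
  have "(1 - fps_X) * ((1 + fps_X) * ball_fps k) = (1 + fps_X) * ((1 - fps_X) * ball_fps k)"
    by (simp only: mult.left_commute)
  also have "\<dots> = (1 - fps_X) * sphere_fps (Suc k)"
    by (simp only: ball_fps sphere_fps_Suc)
  finally have eq: "(1 - fps_X) * ((1 + fps_X) * ball_fps k) = (1 - fps_X) * sphere_fps (Suc k)" .
  have "fps_nth (1 - fps_X :: complex fps) 0 \<noteq> fps_nth 0 0" by simp
  then have "(1 - fps_X :: complex fps) \<noteq> 0" by metis
  with eq show ?thesis by simp
qed


section \<open>Power series modulo a power of the variable\<close>

text \<open>
  Congruence modulo \<open>x\<^sup>q\<close>: only the first \<open>q\<close> coefficients of a series that encodes a matrix row or
  column are entries of that matrix.
\<close>

definition eq_upto :: "nat \<Rightarrow> 'a::comm_ring_1 fps \<Rightarrow> 'a fps \<Rightarrow> bool" where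
  "eq_upto q f g \<longleftrightarrow> (\<forall>n<q. fps_nth f n = fps_nth g n)"

lemma eq_upto_refl [simp]: "eq_upto q f f"
  by (simp add: eq_upto_def)

lemma eq_upto_sym: "eq_upto q f g \<Longrightarrow> eq_upto q g f"
  by (simp add: eq_upto_def)

lemma eq_upto_trans [trans]: "eq_upto q f g \<Longrightarrow> eq_upto q g h \<Longrightarrow> eq_upto q f h"
  by (simp add: eq_upto_def)

lemma eq_upto_mult_left:
  assumes "eq_upto q f g"
  shows "eq_upto q (h * f) (h * g)"
  unfolding eq_upto_def fps_mult_nth
proof (intro allI impI sum.cong refl)
  fix n i assume "n < q" "i \<in> {0..n}"
  then show "fps_nth h i * fps_nth f (n - i) = fps_nth h i * fps_nth g (n - i)"
    using assms by (simp add: eq_upto_def)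
qed

lemma eq_upto_cancel_left:
  assumes "eq_upto q (h * f) (h * g)" and "h' * h = 1"
  shows "eq_upto q f g"
proof -
  have "h' * (h * x) = x" for x by (simp only: mult.assoc[symmetric] assms(2) mult_1_left)
  then show ?thesis using eq_upto_mult_left[OF assms(1), of h'] by (simp only:)
qed

text \<open>The inverse of \<open>1 - x\<close> is the geometric series, which is the ball series of dimension 0.\<close>

lemma inverse_one_minus_X: "ball_fps 0 * (1 - fps_X) = 1"
  using ball_fps[of 0] unfolding sphere_fps_0 by (subst mult.commute)


section \<open>Solving the chain\<close>

text \<open>
  From \<open>c\<^sub>0 = 0\<close> one obtains in turn \<open>v\<^sub>1 = 0\<close>, \<open>c\<^sub>2 = 0\<close>, \<open>v\<^sub>3 = 0\<close>, and so on: each downward equation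
  determines \<open>v\<close> because \<open>1 - x\<close> is a unit, and each upward equation then determines the next \<open>c\<close>.
\<close>

lemma chain_odd_part_zero:
  fixes c v :: "nat \<Rightarrow> complex fps"
  assumes "E * E = 1" and "eq_upto q (c 0) 0"
    and up: "\<forall>i\<in>{1..p}. eq_upto q (c (i + 1)) ((1 + fps_X) * v i)"
    and down: "\<forall>i\<in>{1..p}. eq_upto q (c (i - 1)) (E * (1 - fps_X) * v i)"
  shows "2 * k \<le> p + 1 \<Longrightarrow> eq_upto q (c (2 * k)) 0"
    and "2 * k + 1 \<le> p \<Longrightarrow> eq_upto q (v (2 * k + 1)) 0"
proof -
  have inv: "(E * ball_fps 0) * (E * (1 - fps_X)) = 1"
    by (simp only: mult.assoc mult.left_commute[of "ball_fps 0" E] inverse_one_minus_X assms(1) mult_1_right)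
  have v: "eq_upto q (v (2 * k + 1)) 0" if "2 * k + 1 \<le> p" "eq_upto q (c (2 * k)) 0" for k
  proof -
    have "eq_upto q (E * (1 - fps_X) * v (2 * k + 1)) (c (2 * k))"
      using down[rule_format, of "2 * k + 1"] that by (simp add: eq_upto_sym)
    also note that(2)
    finally show ?thesis
      using eq_upto_cancel_left[OF _ inv, of q "v (2 * k + 1)" 0] by simp
  qed
  have c: "eq_upto q (c (2 * k)) 0" if "2 * k \<le> p + 1" for k
    using that
  proof (induction k)
    case 0
    then show ?case using assms(2) by simp
  next
    case (Suc k)
    have "eq_upto q (c (2 * Suc k)) ((1 + fps_X) * v (2 * k + 1))"
      using up[rule_format, of "2 * k + 1"] Suc.prems by simp
    also have "eq_upto q \<dots> ((1 + fps_X) * 0)"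
      using v[of k] Suc by (intro eq_upto_mult_left) simp
    finally show ?case by simp
  qed
  show "2 * k \<le> p + 1 \<Longrightarrow> eq_upto q (c (2 * k)) 0" by (rule c)
  show "2 * k + 1 \<le> p \<Longrightarrow> eq_upto q (v (2 * k + 1)) 0" using v c by simp
qed

text \<open>
  The same climb from \<open>c\<^sub>1\<close>. Dividing by \<open>1 - x\<close> turns a sphere series into the ball series of the
  same dimension, and multiplying that by \<open>1 + x\<close> gives the sphere series one dimension higher.
\<close>

lemma chain_even_part:
  fixes c v :: "nat \<Rightarrow> complex fps"
  assumes "E * E = 1"
    and up: "\<forall>i\<in>{1..p}. eq_upto q (c (i + 1)) ((1 + fps_X) * v i)"
    and down: "\<forall>i\<in>{1..p}. eq_upto q (c (i - 1)) (E * (1 - fps_X) * v i)"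
  shows "2 * k + 1 \<le> p \<Longrightarrow> eq_upto q (c (2 * k + 1)) (E ^ k * sphere_fps k * c 1)"
    and "2 * k + 2 \<le> p \<Longrightarrow> eq_upto q (v (2 * k + 2)) (E ^ (k + 1) * ball_fps k * c 1)"
proof -
  have inv: "(E * ball_fps 0) * (E * (1 - fps_X)) = 1"
    by (simp only: mult.assoc mult.left_commute[of "ball_fps 0" E] inverse_one_minus_X assms(1) mult_1_right)
  have v: "eq_upto q (v (2 * k + 2)) (E ^ (k + 1) * ball_fps k * c 1)"
    if "2 * k + 2 \<le> p" "eq_upto q (c (2 * k + 1)) (E ^ k * sphere_fps k * c 1)" for k
  proof -
    have "eq_upto q (E * (1 - fps_X) * v (2 * k + 2)) (c (2 * k + 1))"
      using down[rule_format, of "2 * k + 2"] that(1) by (simp add: eq_upto_sym)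
    also note that(2)
    also have "E ^ k * sphere_fps k * c 1
        = (E * E) * E ^ k * ((1 - fps_X) * ball_fps k) * c 1"
      by (simp add: assms(1) ball_fps)
    also have "\<dots> = E * (1 - fps_X) * (E ^ (k + 1) * ball_fps k * c 1)"
      by (simp only: power_add power_one_right mult_ac)
    finally show ?thesis by (rule eq_upto_cancel_left[OF _ inv])
  qed
  have c: "eq_upto q (c (2 * k + 1)) (E ^ k * sphere_fps k * c 1)" if "2 * k + 1 \<le> p" for k
    using that
  proof (induction k)
    case 0
    then show ?case by (simp add: sphere_fps_0)
  next
    case (Suc k)
    have "eq_upto q (c (2 * Suc k + 1)) ((1 + fps_X) * v (2 * k + 2))"
      using up[rule_format, of "2 * k + 2"] Suc.prems by simp
    also have "eq_upto q \<dots> ((1 + fps_X) * (E ^ (k + 1) * ball_fps k * c 1))"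
      using v[of k] Suc by (intro eq_upto_mult_left) simp
    also have "(1 + fps_X) * (E ^ (k + 1) * ball_fps k * c 1)
        = E ^ (k + 1) * ((1 + fps_X) * ball_fps k) * c 1"
      by (simp only: mult_ac)
    also have "\<dots> = E ^ Suc k * sphere_fps (Suc k) * c 1"
      by (simp only: ball_fps_Suc Suc_eq_plus1)
    finally show ?case .
  qed
  show "2 * k + 1 \<le> p \<Longrightarrow> eq_upto q (c (2 * k + 1)) (E ^ k * sphere_fps k * c 1)"
    by (rule c)
  show "2 * k + 2 \<le> p \<Longrightarrow> eq_upto q (v (2 * k + 2)) (E ^ (k + 1) * ball_fps k * c 1)"
    using v c by simp
qed

text \<open>
  The parameter \<open>b\<close> is the series of \<open>c\<^sub>1\<close>. The parity of \<open>p\<close> matters for the converse: the boundary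
  condition at \<open>p + 1\<close> falls on the vanishing chain and so puts no restriction on \<open>b\<close>.
\<close>

lemma chain_solution:
  fixes c v :: "nat \<Rightarrow> complex fps"
  assumes "odd p" and E: "E * E = 1" and c0: "c 0 = 0" and cp: "c (p + 1) = 0"
  shows "(\<forall>i\<in>{1..p}. eq_upto q (c (i + 1)) ((1 + fps_X) * v i) \<and>
             eq_upto q (c (i - 1)) (E * (1 - fps_X) * v i)) \<longleftrightarrow>
    (\<exists>b. (\<forall>j\<in>{1..p}. eq_upto q (c j)
              (if even j then 0 else E ^ (j div 2) * sphere_fps (j div 2) * b)) \<and>
         (\<forall>i\<in>{1..p}. eq_upto q (v i)
              (if odd i then 0 else E ^ (i div 2) * ball_fps (i div 2 - 1) * b)))"
    (is "?L \<longleftrightarrow> (\<exists>b. ?C b \<and> ?V b)")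
proof
  assume L: ?L
  have up: "\<forall>i\<in>{1..p}. eq_upto q (c (i + 1)) ((1 + fps_X) * v i)"
    and down: "\<forall>i\<in>{1..p}. eq_upto q (c (i - 1)) (E * (1 - fps_X) * v i)"
    using L by blast+
  have c0': "eq_upto q (c 0) 0" by (simp add: c0)
  note zero = chain_odd_part_zero[OF E c0' up down]
  note even = chain_even_part[OF E up down]
  have "?C (c 1)"
  proof
    fix j assume j: "j \<in> {1..p}"
    show "eq_upto q (c j) (if even j then 0 else E ^ (j div 2) * sphere_fps (j div 2) * c 1)"
      using zero(1)[of "j div 2"] even(1)[of "j div 2"] j by auto
  qed
  moreover have "?V (c 1)"
  proof
    fix i assume i: "i \<in> {1..p}"
    show "eq_upto q (v i) (if odd i then 0 else E ^ (i div 2) * ball_fps (i div 2 - 1) * c 1)"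
    proof (cases "odd i")
      case True
      then show ?thesis using zero(2)[of "i div 2"] i by auto
    next
      case False
      with i have "i = 2 * (i div 2 - 1) + 2" by auto
      then obtain k where "i = 2 * k + 2" ..
      then show ?thesis using even(2)[of k] i by simp
    qed
  qed
  ultimately show "\<exists>b. ?C b \<and> ?V b" by blast
next
  assume "\<exists>b. ?C b \<and> ?V b"
  then obtain b where C: "?C b" and V: "?V b" by blast
  have c_even: "eq_upto q (c j) 0" if "even j" "j \<le> p + 1" for j
    using C[rule_format, of j] that c0 cp by (cases "j = 0 \<or> j = p + 1") auto
  have c_odd: "eq_upto q (c (2 * k + 1)) (E ^ k * sphere_fps k * b)" if "2 * k + 1 \<le> p" for k
    using C[rule_format, of "2 * k + 1"] that by simp
  show ?L
  proof
    fix i assume i: "i \<in> {1..p}"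
    show "eq_upto q (c (i + 1)) ((1 + fps_X) * v i) \<and>
        eq_upto q (c (i - 1)) (E * (1 - fps_X) * v i)"
    proof (cases "odd i")
      case True
      have v0: "eq_upto q 0 (v i)" using V[rule_format, OF i] True by (auto intro: eq_upto_sym)
      have "eq_upto q (c (i + 1)) 0" "eq_upto q (c (i - 1)) 0"
        using True i by (auto intro!: c_even)
      then show ?thesis
        using eq_upto_mult_left[OF v0, of "1 + fps_X"] eq_upto_mult_left[OF v0, of "E * (1 - fps_X)"]
        by (auto intro: eq_upto_trans)
    next
      case False
      with i have "i = 2 * (i div 2 - 1) + 2" by auto
      then obtain k where k: "i = 2 * k + 2" ..
      \<comment> \<open>As \<open>p\<close> is odd, the even index \<open>i\<close> has a successor within range.\<close>
      have "i < p" using i k \<open>odd p\<close> by (cases "i = p") auto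
      then have bound: "2 * (k + 1) + 1 \<le> p" using k by simp
      have v: "eq_upto q (E ^ (k + 1) * ball_fps k * b) (v i)"
        using V[rule_format, OF i] k by (auto intro: eq_upto_sym)
      have "eq_upto q (c (i + 1)) (E ^ (k + 1) * sphere_fps (k + 1) * b)"
        using c_odd[OF bound] k by simp
      also have "\<dots> = (1 + fps_X) * (E ^ (k + 1) * ball_fps k * b)"
        by (simp add: ball_fps_Suc[symmetric] mult_ac)
      also have "eq_upto q \<dots> ((1 + fps_X) * v i)"
        by (rule eq_upto_mult_left[OF v])
      finally have up: "eq_upto q (c (i + 1)) ((1 + fps_X) * v i)" .
      have "eq_upto q (c (i - 1)) (E ^ k * sphere_fps k * b)"
        using c_odd[of k] bound k by simp
      also have "E ^ k * sphere_fps k * b = (E * E) * E ^ k * ((1 - fps_X) * ball_fps k) * b"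
        by (simp add: E ball_fps)
      also have "\<dots> = E * (1 - fps_X) * (E ^ (k + 1) * ball_fps k * b)"
        by (simp only: power_add power_one_right mult_ac)
      also have "eq_upto q \<dots> (E * (1 - fps_X) * v i)"
        by (rule eq_upto_mult_left[OF v])
      finally show ?thesis using up by blast
    qed
  qed
qed


section \<open>The matrix equation, entry by entry\<close>

lemma four_block_mat_eq_zero_iff:
  assumes "A \<in> carrier_mat p p" "B \<in> carrier_mat p q"
    and "C \<in> carrier_mat q p" "D \<in> carrier_mat q q"
  shows "four_block_mat A B C D = 0\<^sub>m (p + q) (p + q) \<longleftrightarrow>
    A = 0\<^sub>m p p \<and> B = 0\<^sub>m p q \<and> C = 0\<^sub>m q p \<and> D = 0\<^sub>m q q"
proof
  assume eq: "four_block_mat A B C D = 0\<^sub>m (p + q) (p + q)"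
  have entry: "four_block_mat A B C D $$ (i, j) = 0" if "i < p + q" "j < p + q" for i j
    using that by (simp add: eq)
  have "A $$ (i, j) = 0" if "i < p" "j < p" for i j
    using entry[of i j] that assms by simp
  moreover have "B $$ (i, j) = 0" if "i < p" "j < q" for i j
    using entry[of i "p + j"] that assms by simp
  moreover have "C $$ (i, j) = 0" if "i < q" "j < p" for i j
    using entry[of "p + i" j] that assms by simp
  moreover have "D $$ (i, j) = 0" if "i < q" "j < q" for i j
    using entry[of "p + i" "p + j"] that assms by simp
  ultimately show "A = 0\<^sub>m p p \<and> B = 0\<^sub>m p q \<and> C = 0\<^sub>m q p \<and> D = 0\<^sub>m q q"
    using assms by (auto intro!: eq_matI)
next
  assume "A = 0\<^sub>m p p \<and> B = 0\<^sub>m p q \<and> C = 0\<^sub>m q p \<and> D = 0\<^sub>m q q"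
  then show "four_block_mat A B C D = 0\<^sub>m (p + q) (p + q)" by simp
qed

lemma block_equation_iff:
  fixes A B C D J G :: "complex mat"
  assumes "A \<in> carrier_mat p p" "B \<in> carrier_mat p q"
    and "C \<in> carrier_mat q p" "D \<in> carrier_mat q q"
    and "J \<in> carrier_mat p p" "G \<in> carrier_mat q q"
  shows "four_block_mat A B C D * diag_block_mat [J, G]
      + diag_block_mat [J, G] * transpose_mat (four_block_mat A B C D) = 0\<^sub>m (p + q) (p + q) \<longleftrightarrow>
    A * J + J * transpose_mat A = 0\<^sub>m p p \<and> D * G + G * transpose_mat D = 0\<^sub>m q q \<and>
    B * G + J * transpose_mat C = 0\<^sub>m p q \<and> C * J + G * transpose_mat B = 0\<^sub>m q p"
proof -
  have diag: "diag_block_mat [J, G] = four_block_mat J (0\<^sub>m p q) (0\<^sub>m q p) G"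
    unfolding diag_block_mat.simps(2)[of J] diag_block_mat_singleton
    using assms by (simp add: Let_def)
  have "four_block_mat A B C D * diag_block_mat [J, G]
      + diag_block_mat [J, G] * transpose_mat (four_block_mat A B C D)
    = four_block_mat (A * J) (B * G) (C * J) (D * G) +
      four_block_mat (J * transpose_mat A) (J * transpose_mat C)
        (G * transpose_mat B) (G * transpose_mat D)"
    unfolding diag transpose_four_block_mat[OF assms(1-4)]
    using assms by (simp add: mult_four_block_mat[of _ p p _ q _ q _ _ p _ q])
  also have "\<dots> = four_block_mat (A * J + J * transpose_mat A) (B * G + J * transpose_mat C)
      (C * J + G * transpose_mat B) (D * G + G * transpose_mat D)"
    using assms by (intro add_four_block_mat) auto
  finally have eq: "four_block_mat A B C D * diag_block_mat [J, G]
      + diag_block_mat [J, G] * transpose_mat (four_block_mat A B C D) = \<dots>" .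
  have "A * J + J * transpose_mat A \<in> carrier_mat p p"
    "B * G + J * transpose_mat C \<in> carrier_mat p q"
    "C * J + G * transpose_mat B \<in> carrier_mat q p"
    "D * G + G * transpose_mat D \<in> carrier_mat q q"
    using assms by auto
  from four_block_mat_eq_zero_iff[OF this] show ?thesis
    unfolding eq by blast
qed

lemma Gamma_block_dim [simp]:
  "Gamma_block q \<in> carrier_mat q q" "dim_row (Gamma_block q) = q" "dim_col (Gamma_block q) = q"
  by (simp_all add: Gamma_block_def)

text \<open>
  Each column and row of the matrix has at most two nonzero entries, which are adjacent, of opposite
  sign in a column and of equal sign in a row. In the alternating coordinates of \<open>row_fps\<close> below, the
  difference becomes the factor \<open>1 + x\<close> and the sum the factor \<open>1 - x\<close>.
\<close>

lemma sum_Gamma_col: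
  fixes f :: "nat \<Rightarrow> complex"
  assumes "n < q"
  shows "(\<Sum>m<q. f m * Gamma_block q $$ (m, n))
    = (-1) ^ n * (f (q - 1 - n) - (if n = 0 then 0 else f (q - n)))"
proof -
  have "(\<Sum>m<q. f m * Gamma_block q $$ (m, n)) =
      (\<Sum>m<q. (if m = q - 1 - n then (-1) ^ n * f m else 0)
            + (if m = q - n then - ((-1) ^ n) * f m else 0))"
    using assms by (intro sum.cong refl) (auto simp: Gamma_block_def Let_def)
  also have "\<dots> = (-1) ^ n * (f (q - 1 - n) - (if n = 0 then 0 else f (q - n)))"
    using assms by (simp add: sum.distrib sum.delta algebra_simps)
  finally show ?thesis .
qed

lemma sum_Gamma_row:
  fixes f :: "nat \<Rightarrow> complex"
  assumes "n < q"
  shows "(\<Sum>m<q. Gamma_block q $$ (n, m) * f m)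
    = (-1) ^ (q - 1 - n) * (f (q - 1 - n) + (if n = 0 then 0 else f (q - n)))"
proof -
  have "(\<Sum>m<q. Gamma_block q $$ (n, m) * f m) =
      (\<Sum>m<q. (if m = q - 1 - n then (-1) ^ (q - 1 - n) * f m else 0)
            + (if m = q - n then (-1) ^ (q - 1 - n) * f m else 0))"
  proof (intro sum.cong refl)
    fix m assume "m \<in> {..<q}"
    moreover have "q - n = Suc (q - 1 - n)" using assms by simp
    ultimately show "Gamma_block q $$ (n, m) * f m =
      (if m = q - 1 - n then (-1) ^ (q - 1 - n) * f m else 0)
            + (if m = q - n then (-1) ^ (q - 1 - n) * f m else 0)"
      using assms by (auto simp: Gamma_block_def Let_def)
  qed
  also have "\<dots> = (-1) ^ (q - 1 - n) * (f (q - 1 - n) + (if n = 0 then 0 else f (q - n)))"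
    using assms by (simp add: sum.distrib sum.delta algebra_simps)
  finally show ?thesis .
qed

text \<open>
  The columns 0 and \<open>p + 1\<close> that the shift \<open>J\<close> refers to at its ends count as zero, so that the
  boundary equations take the same form as the others.
\<close>

definition col_fps :: "complex mat \<Rightarrow> nat \<Rightarrow> nat \<Rightarrow> complex fps" where
  "col_fps C p j = (if j = 0 \<or> p < j then 0 else Abs_fps (\<lambda>n. entry C (n + 1) j))"

text \<open>
  The reversal undoes the antidiagonal shape of \<open>\<Gamma>\<close> and the sign undoes its alternation. The offset
  in the exponent absorbs the minus sign from moving \<open>B \<Gamma>\<close> to the other side of the equation.
  The coefficients from \<open>n = q\<close> on are arbitrary values, invisible modulo \<open>x\<^sup>q\<close>.
\<close>

definition row_fps :: "complex mat \<Rightarrow> nat \<Rightarrow> nat \<Rightarrow> complex fps" where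
  "row_fps B q i = Abs_fps (\<lambda>n. (-1) ^ (n + 1) * entry B i (q - n))"

lemma upper_right_entry:
  assumes "B \<in> carrier_mat p q" "C \<in> carrier_mat q p" "i \<in> {1..p}" "n < q"
  shows "(B * Gamma_block q + jordan_block p 0 * transpose_mat C) $$ (i - 1, n) =
    fps_nth (col_fps C p (i + 1)) n - fps_nth ((1 + fps_X) * row_fps B q i) n"
proof -
  have i: "i - 1 < p" using assms(3) by auto
  then have "(B * Gamma_block q) $$ (i - 1, n) = (\<Sum>m<q. B $$ (i - 1, m) * Gamma_block q $$ (m, n))"
    using assms by (simp add: scalar_prod_def atLeast0LessThan)
  also have "\<dots> = - fps_nth ((1 + fps_X) * row_fps B q i) n"
    unfolding sum_Gamma_col[OF assms(4)]
    using assms by (cases n) (simp_all add: row_fps_def entry_def algebra_simps)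
  finally have 1: "(B * Gamma_block q) $$ (i - 1, n) = - fps_nth ((1 + fps_X) * row_fps B q i) n" .
  have "(jordan_block p 0 * transpose_mat C) $$ (i - 1, n) =
      (\<Sum>m<p. (if i - 1 = m then 0 else if Suc (i - Suc 0) = m then 1 else 0) * C $$ (n, m))"
    using assms i by (simp add: scalar_prod_def atLeast0LessThan)
  also have "\<dots> = (\<Sum>m<p. if m = i then C $$ (n, m) else 0)"
    using assms by (intro sum.cong) auto
  also have "\<dots> = fps_nth (col_fps C p (i + 1)) n"
    using assms by (auto simp: col_fps_def entry_def sum.delta)
  finally have 2: "(jordan_block p 0 * transpose_mat C) $$ (i - 1, n) =
      fps_nth (col_fps C p (i + 1)) n" .
  have "(B * Gamma_block q + jordan_block p 0 * transpose_mat C) $$ (i - 1, n) =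
      (B * Gamma_block q) $$ (i - 1, n) + (jordan_block p 0 * transpose_mat C) $$ (i - 1, n)"
    using assms by (intro index_add_mat) auto
  then show ?thesis by (simp only: 1 2 diff_conv_add_uminus add.commute)
qed

lemma lower_left_entry:
  assumes "B \<in> carrier_mat p q" "C \<in> carrier_mat q p" "i \<in> {1..p}" "n < q"
  shows "(C * jordan_block p 0 + Gamma_block q * transpose_mat B) $$ (n, i - 1) =
    fps_nth (col_fps C p (i - 1)) n
      - fps_nth (fps_const ((-1) ^ (q - 1)) * (1 - fps_X) * row_fps B q i) n"
proof -
  have sign: "(-1) ^ (q - 1 - n) = ((-1) ^ (q - 1) * (-1) ^ n :: complex)"
    using assms(4) by (simp flip: power_add add: minus_one_power_iff)
  have "i - 1 < p" using assms(3) by auto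
  then have "(Gamma_block q * transpose_mat B) $$ (n, i - 1) =
      (\<Sum>m<q. Gamma_block q $$ (n, m) * B $$ (i - 1, m))"
    using assms by (simp add: scalar_prod_def atLeast0LessThan)
  also have "\<dots> = - fps_nth (fps_const ((-1) ^ (q - 1)) * (1 - fps_X) * row_fps B q i) n"
    unfolding sum_Gamma_row[OF assms(4)] sign mult.assoc fps_mult_left_const_nth
    using assms by (cases n) (simp_all add: row_fps_def entry_def algebra_simps)
  finally have 1: "(Gamma_block q * transpose_mat B) $$ (n, i - 1) =
      - fps_nth (fps_const ((-1) ^ (q - 1)) * (1 - fps_X) * row_fps B q i) n" .
  have "(C * jordan_block p 0) $$ (n, i - 1) =
      (\<Sum>m<p. if Suc m = i - 1 then C $$ (n, m) else 0)"
    using assms by (auto simp: scalar_prod_def atLeast0LessThan intro!: sum.cong)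
  \<comment> \<open>For \<open>i = 1\<close> truncated subtraction would select column 0 instead of none.\<close>
  also have "\<dots> = (\<Sum>m<p. if m = i - 2 then (if i = 1 then 0 else C $$ (n, m)) else 0)"
    using assms by (intro sum.cong) auto
  also have "\<dots> = fps_nth (col_fps C p (i - 1)) n"
    using assms by (auto simp: col_fps_def entry_def sum.delta numeral_2_eq_2)
  finally have 2: "(C * jordan_block p 0) $$ (n, i - 1) = fps_nth (col_fps C p (i - 1)) n" .
  have "(C * jordan_block p 0 + Gamma_block q * transpose_mat B) $$ (n, i - 1) =
      (C * jordan_block p 0) $$ (n, i - 1) + (Gamma_block q * transpose_mat B) $$ (n, i - 1)"
    using assms by (intro index_add_mat) auto
  then show ?thesis by (simp only: 1 2 diff_conv_add_uminus add.commute)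
qed

lemma mat_eq_zero_iff:
  assumes "M \<in> carrier_mat r s"
  shows "M = 0\<^sub>m r s \<longleftrightarrow> (\<forall>i<r. \<forall>j<s. M $$ (i, j) = 0)"
  using assms by (auto intro!: eq_matI)

lemma off_diagonal_blocks_iff_chain:
  assumes "B \<in> carrier_mat p q" "C \<in> carrier_mat q p"
  shows "B * Gamma_block q + jordan_block p 0 * transpose_mat C = 0\<^sub>m p q \<and>
      C * jordan_block p 0 + Gamma_block q * transpose_mat B = 0\<^sub>m q p \<longleftrightarrow>
    (\<forall>i\<in>{1..p}. eq_upto q (col_fps C p (i + 1)) ((1 + fps_X) * row_fps B q i) \<and>
      eq_upto q (col_fps C p (i - 1))
        (fps_const ((-1) ^ (q - 1)) * (1 - fps_X) * row_fps B q i))"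
    (is "?M = 0\<^sub>m p q \<and> ?N = 0\<^sub>m q p \<longleftrightarrow> ?R")
proof -
  have shift: "(\<forall>i<p. P i) \<longleftrightarrow> (\<forall>i\<in>{1..p}. P (i - 1))" for P
    unfolding One_nat_def[symmetric] image_Suc_lessThan[symmetric] by auto
  have M: "?M \<in> carrier_mat p q" and N: "?N \<in> carrier_mat q p" using assms by auto
  have "?M = 0\<^sub>m p q \<and> ?N = 0\<^sub>m q p \<longleftrightarrow>
      (\<forall>i<p. \<forall>n<q. ?M $$ (i, n) = 0 \<and> ?N $$ (n, i) = 0)"
    unfolding mat_eq_zero_iff[OF M] mat_eq_zero_iff[OF N] by blast
  also have "\<dots> \<longleftrightarrow> (\<forall>i\<in>{1..p}. \<forall>n<q. ?M $$ (i - 1, n) = 0 \<and> ?N $$ (n, i - 1) = 0)"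
    by (rule shift)
  also have "\<dots> \<longleftrightarrow> ?R"
  proof (intro ball_cong refl)
    fix i assume i: "i \<in> {1..p}"
    show "(\<forall>n<q. ?M $$ (i - 1, n) = 0 \<and> ?N $$ (n, i - 1) = 0) \<longleftrightarrow>
      eq_upto q (col_fps C p (i + 1)) ((1 + fps_X) * row_fps B q i) \<and>
      eq_upto q (col_fps C p (i - 1))
        (fps_const ((-1) ^ (q - 1)) * (1 - fps_X) * row_fps B q i)"
      unfolding eq_upto_def
      by (simp only: upper_right_entry[OF assms i] lower_left_entry[OF assms i] right_minus_eq
          cong: imp_cong) blast
  qed
  finally show ?thesis .
qed


section \<open>Reading off the entries\<close>

lemma col_fps_entries:
  fixes b :: "complex fps" and \<beta> :: "nat \<Rightarrow> complex"
  assumes j: "j \<in> {1..p}" and \<beta>: "\<And>n. fps_nth b n = \<beta> (n + 1)"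
  shows "eq_upto q (col_fps C p j) (if even j then 0
        else fps_const ((-1) ^ (q - 1)) ^ (j div 2) * sphere_fps (j div 2) * b) \<longleftrightarrow>
    (\<forall>i\<in>{1..q}. entry C i j =
               (if even j then 0
                else (-1) ^ ((j div 2) * (q - 1)) *
                     (\<Sum>l=0..i - 1. of_nat (coord_seq (j div 2) l) * \<beta> (i - l))))"
proof -
  have conv: "fps_nth (sphere_fps k * b) n =
      (\<Sum>l=0..n. of_nat (coord_seq k l) * \<beta> (Suc n - l))" for k n
    by (simp add: fps_mult_nth \<beta> sphere_fps_def Suc_diff_le)
  have "eq_upto q (col_fps C p j) (if even j then 0
        else fps_const ((-1) ^ (q - 1)) ^ (j div 2) * sphere_fps (j div 2) * b) \<longleftrightarrow>
    (\<forall>n<q. entry C (Suc n) j =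
               (if even j then 0
                else (-1) ^ ((j div 2) * (q - 1)) *
                     (\<Sum>l=0..n. of_nat (coord_seq (j div 2) l) * \<beta> (Suc n - l))))"
    using j by (auto simp: eq_upto_def col_fps_def mult.assoc conv fps_const_power
        mult.commute[of "j div 2"] simp flip: power_mult)
  also have "\<dots> \<longleftrightarrow> (\<forall>i\<in>Suc ` {..<q}. entry C i j =
               (if even j then 0
                else (-1) ^ ((j div 2) * (q - 1)) *
                     (\<Sum>l=0..i - 1. of_nat (coord_seq (j div 2) l) * \<beta> (i - l))))"
    by auto
  also have "Suc ` {..<q} = {1..q}"
    by (simp add: image_Suc_lessThan)
  finally show ?thesis .
qed

text \<open>
  The coefficient \<open>n\<close> of the series belongs to the entry in column \<open>q - n\<close>, hence the convolution in
  the statement runs up to \<open>q - j\<close>.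
\<close>

lemma row_fps_entries:
  fixes b :: "complex fps" and \<beta> :: "nat \<Rightarrow> complex"
  assumes i: "i \<in> {1..p}" and \<beta>: "\<And>n. fps_nth b n = \<beta> (n + 1)"
  shows "eq_upto q (row_fps B q i) (if odd i then 0
        else fps_const ((-1) ^ (q - 1)) ^ (i div 2) * ball_fps (i div 2 - 1) * b) \<longleftrightarrow>
    (\<forall>j\<in>{1..q}. (odd i \<longrightarrow> entry B i j = 0) \<and>
             (\<forall>k. i = 2 * k \<longrightarrow>
                entry B i j =
                  (-1) ^ (j + (k + 1) * (q - 1)) *
                  (\<Sum>l=0..q - j. of_nat (coord_seq_sum (k - 1) l) * \<beta> (q - j - l + 1))))"
    (is "?L \<longleftrightarrow> (\<forall>j\<in>{1..q}. ?R j)")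
proof -
  have conv: "fps_nth (ball_fps k * b) n =
      (\<Sum>l=0..n. of_nat (coord_seq_sum k l) * \<beta> (n - l + 1))" for k n
    by (simp add: fps_mult_nth \<beta> ball_fps_def)
  have nat_iff: "(-1) ^ (n + 1) * entry B i (q - n) = (if odd i then 0
        else (-1) ^ ((q - 1) * (i div 2)) * fps_nth (ball_fps (i div 2 - 1) * b) n) \<longleftrightarrow> ?R (q - n)"
    if n: "n < q" for n
  proof (cases "odd i")
    case True
    then show ?thesis by auto
  next
    case False
    then obtain k where k: "i = 2 * k" by (auto elim: evenE)
    \<comment> \<open>The sign of the claimed formula, taken at column \<open>q - n\<close>, is the sign in \<open>row_fps\<close> times
      \<open>\<epsilon>\<^sup>k\<close>.\<close>
    have sign: "(-1) ^ (q - n + (k + 1) * (q - 1)) =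
        ((-1) ^ (n + 1) * (-1) ^ ((q - 1) * k) :: complex)"
    proof -
      have "even (q - n + (k + 1) * (q - 1)) \<longleftrightarrow> even (n + 1 + (q - 1) * k)"
        using n by (cases q) auto
      then show ?thesis by (simp add: minus_one_power_iff flip: power_add)
    qed
    have sq: "(-1) ^ (n + 1) * ((-1) ^ (n + 1) * x) = x" for x :: complex
      by (simp add: minus_one_power_iff)
    have swap: "(-1) ^ (n + 1) * x = y \<longleftrightarrow> x = (-1) ^ (n + 1) * y" for x y :: complex
      using sq by metis
    have "?R (q - n) \<longleftrightarrow> entry B i (q - n) =
        (-1) ^ (q - n + (k + 1) * (q - 1)) * fps_nth (ball_fps (k - 1) * b) n"
      using n k by (simp add: conv)
    also have "\<dots> \<longleftrightarrow> entry B i (q - n) =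
        (-1) ^ (n + 1) * ((-1) ^ ((q - 1) * k) * fps_nth (ball_fps (k - 1) * b) n)"
      by (simp only: sign mult.assoc)
    also have "\<dots> \<longleftrightarrow> (-1) ^ (n + 1) * entry B i (q - n) =
        (-1) ^ ((q - 1) * k) * fps_nth (ball_fps (k - 1) * b) n"
      by (rule swap[symmetric])
    finally show ?thesis using k by simp
  qed
  have "?L \<longleftrightarrow> (\<forall>n<q. (-1) ^ (n + 1) * entry B i (q - n) = (if odd i then 0
        else (-1) ^ ((q - 1) * (i div 2)) * fps_nth (ball_fps (i div 2 - 1) * b) n))"
    by (auto simp: eq_upto_def row_fps_def mult.assoc fps_const_power simp flip: power_mult)
  also have "\<dots> \<longleftrightarrow> (\<forall>n<q. ?R (q - n))"
    using nat_iff by blast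
  also have "\<dots> \<longleftrightarrow> (\<forall>j\<in>(\<lambda>n. q - n) ` {..<q}. ?R j)"
    by blast
  also have "(\<lambda>n. q - n) ` {..<q} = {1..q}"
  proof
    show "{1..q} \<subseteq> (\<lambda>n. q - n) ` {..<q}"
    proof
      fix j assume "j \<in> {1..q}"
      then have "j = q - (q - j)" "q - j < q" by auto
      then show "j \<in> (\<lambda>n. q - n) ` {..<q}" by blast
    qed
  qed auto
  finally show ?thesis .
qed

theorem mainTheorem2:
  fixes p q :: nat and A B C D X :: "complex mat"
  assumes "p \<ge> 1" and "q \<ge> 1" and "odd p"
    and "A \<in> carrier_mat p p" and "B \<in> carrier_mat p q"
    and "C \<in> carrier_mat q p" and "D \<in> carrier_mat q q"
    and "X = four_block_mat A B C D"
  shows "X * diag_block_mat [jordan_block p 0, Gamma_block q]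
           + diag_block_mat [jordan_block p 0, Gamma_block q] * transpose_mat X
         = 0\<^sub>m (p + q) (p + q)
     \<longleftrightarrow>
       A * jordan_block p 0 + jordan_block p 0 * transpose_mat A = 0\<^sub>m p p \<and>
       D * Gamma_block q + Gamma_block q * transpose_mat D = 0\<^sub>m q q \<and>
       (\<exists>\<beta> :: nat \<Rightarrow> complex.
          (\<forall>i\<in>{1..q}. \<forall>j\<in>{1..p}.
             entry C i j =
               (if even j then 0
                else (-1) ^ ((j div 2) * (q - 1)) *
                     (\<Sum>l=0..i - 1. of_nat (coord_seq (j div 2) l) * \<beta> (i - l)))) \<and>
          (\<forall>i\<in>{1..p}. \<forall>j\<in>{1..q}.
             (odd i \<longrightarrow> entry B i j = 0) \<and>
             (\<forall>k. i = 2 * k \<longrightarrow>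
                entry B i j =
                  (-1) ^ (j + (k + 1) * (q - 1)) *
                  (\<Sum>l=0..q - j. of_nat (coord_seq_sum (k - 1) l) * \<beta> (q - j - l + 1)))))"
proof -
  let ?J = "jordan_block p (0 :: complex)" and ?G = "Gamma_block q"
  let ?E = "fps_const ((-1) ^ (q - 1)) :: complex fps"
  let ?C = "\<lambda>b. \<forall>j\<in>{1..p}. eq_upto q (col_fps C p j)
      (if even j then 0 else ?E ^ (j div 2) * sphere_fps (j div 2) * b)"
  let ?V = "\<lambda>b. \<forall>i\<in>{1..p}. eq_upto q (row_fps B q i)
      (if odd i then 0 else ?E ^ (i div 2) * ball_fps (i div 2 - 1) * b)"
  let ?C' = "\<lambda>\<beta> :: nat \<Rightarrow> complex. \<forall>i\<in>{1..q}. \<forall>j\<in>{1..p}.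
             entry C i j =
               (if even j then 0
                else (-1) ^ ((j div 2) * (q - 1)) *
                     (\<Sum>l=0..i - 1. of_nat (coord_seq (j div 2) l) * \<beta> (i - l)))"
  let ?V' = "\<lambda>\<beta> :: nat \<Rightarrow> complex. \<forall>i\<in>{1..p}. \<forall>j\<in>{1..q}.
             (odd i \<longrightarrow> entry B i j = 0) \<and>
             (\<forall>k. i = 2 * k \<longrightarrow>
                entry B i j =
                  (-1) ^ (j + (k + 1) * (q - 1)) *
                  (\<Sum>l=0..q - j. of_nat (coord_seq_sum (k - 1) l) * \<beta> (q - j - l + 1)))"
  have E: "?E * ?E = 1"
    by (simp add: minus_one_power_iff flip: power_add)
  have "?J \<in> carrier_mat p p" "?G \<in> carrier_mat q q" by auto
  note blocks = block_equation_iff[OF assms(4-7) this]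
  have "B * ?G + ?J * transpose_mat C = 0\<^sub>m p q \<and> C * ?J + ?G * transpose_mat B = 0\<^sub>m q p \<longleftrightarrow>
      (\<exists>b. ?C b \<and> ?V b)"
    unfolding off_diagonal_blocks_iff_chain[OF assms(5,6)]
    by (rule chain_solution[OF \<open>odd p\<close> E]) (simp_all add: col_fps_def)
  also have "\<dots> \<longleftrightarrow> (\<exists>\<beta>. ?C' \<beta> \<and> ?V' \<beta>)"
  proof -
    have convert: "?C b \<and> ?V b \<longleftrightarrow> ?C' \<beta> \<and> ?V' \<beta>"
      if "\<And>n. fps_nth b n = \<beta> (n + 1)" for b :: "complex fps" and \<beta>
    proof -
      have "?C b \<longleftrightarrow> (\<forall>j\<in>{1..p}. \<forall>i\<in>{1..q}.
             entry C i j =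
               (if even j then 0
                else (-1) ^ ((j div 2) * (q - 1)) *
                     (\<Sum>l=0..i - 1. of_nat (coord_seq (j div 2) l) * \<beta> (i - l))))"
        by (intro ball_cong refl col_fps_entries that)
      also have "\<dots> \<longleftrightarrow> ?C' \<beta>" by blast
      finally have C: "?C b \<longleftrightarrow> ?C' \<beta>" .
      have V: "?V b \<longleftrightarrow> ?V' \<beta>"
        by (intro ball_cong refl row_fps_entries that)
      show ?thesis by (simp only: C V)
    qed
    show ?thesis
    proof
      assume "\<exists>b. ?C b \<and> ?V b"
      then obtain b where b: "?C b \<and> ?V b" ..
      have "?C' (\<lambda>n. fps_nth b (n - 1)) \<and> ?V' (\<lambda>n. fps_nth b (n - 1))"
        by (rule convert[of b "\<lambda>n. fps_nth b (n - 1)", THEN iffD1, OF _ b]) simp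
      then show "\<exists>\<beta>. ?C' \<beta> \<and> ?V' \<beta>"
        by (rule exI[of _ "\<lambda>n. fps_nth b (n - 1)"])
    next
      assume "\<exists>\<beta>. ?C' \<beta> \<and> ?V' \<beta>"
      then obtain \<beta> where \<beta>: "?C' \<beta> \<and> ?V' \<beta>" ..
      have "?C (Abs_fps (\<lambda>n. \<beta> (n + 1))) \<and> ?V (Abs_fps (\<lambda>n. \<beta> (n + 1)))"
        by (rule convert[of "Abs_fps (\<lambda>n. \<beta> (n + 1))" \<beta>, THEN iffD2, OF _ \<beta>]) simp
      then show "\<exists>b. ?C b \<and> ?V b"
        by (rule exI[of _ "Abs_fps (\<lambda>n. \<beta> (n + 1))"])
    qed
  qed
  finally have off_diagonal: "B * ?G + ?J * transpose_mat C = 0\<^sub>m p q \<and>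
      C * ?J + ?G * transpose_mat B = 0\<^sub>m q p \<longleftrightarrow> (\<exists>\<beta>. ?C' \<beta> \<and> ?V' \<beta>)" .
  show ?thesis
    by (simp only: assms(8) blocks off_diagonal)
qed

end
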